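(* Let $\mathbb{K}$ be a field of characteristic $0$ and $D=(b|g;f_1,f_2)=(d_{n,k})_{n,k\ge0}$ a double almost-Riordan array with $b=\sum_kb_{2k}t^{2k}$, $g=\sum_kg_{2k}t^{2k}$ even ($b_0,g_0\neq0$) and $f_1,f_2$ odd of order $1$; assume an odd order-$1$ series $\sqrt{f_1f_2}$ with square $f_1f_2$ exists and let $\overline{f_{12}}$ be its compositional inverse. Let $\overline{\overline{D}}=(d_{n+2,k})_{n,k\ge0}$ be $D$ with its first two rows deleted. Then the production matrix $P=D^{-1}\overline{\overline{D}}$ is the matrix whose columns $0,1,2,3,4,\ldots$ have generating functions $$\big(W(t),\ tZ_1(t),\ Z_2(t),\ tA(t),\ t^2A(t),\ t^3A(t),\ldots\big)$$ (column $k\ge3$ having generating function $t^{k-2}A(t)$), where $$W(t)=\frac{b_2}{b_0}+\frac{f_2(\overline{f_{12}})}{b_0\overline{f_{12}}^3g(\overline{f_{12}})}\Big(b(\overline{f_{12}})(b_0-b_2\overline{f_{12}}^2)-b_0^2\Big),\qquad Z_1(t)=\frac1{\overline{f_{12}}^2}\Big(1-\frac{g_0}{g(\overline{f_{12}})}\Big),$$ $$Z_2(t)=\frac{g_0f_{1,1}}{b_0}+\frac{t^2}{\overline{f_{12}}^2}-\frac{g_0f_{1,1}b(\overline{f_{12}})f_2(\overline{f_{12}})}{b_0\overline{f_{12}}g(\overline{f_{12}})},\qquad A(t)=\frac{t^2}{\overline{f_{12}}^2},$$ with $f_{1,1}=[t]f_1(t)$.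
   Context: The double almost-Riordan array $(b|g;f_1,f_2)$ is the infinite lower triangular matrix whose $k$-th column has generating function $b$ for $k=0$, $tg(f_1f_2)^{\ell}$ for $k=2\ell+1$, and $tgf_1(f_1f_2)^{\ell}$ for $k=2\ell+2$; its diagonal entries are nonzero, so $D^{-1}$ exists. A matrix is identified with the sequence of generating functions of its columns. *)

theory Defs
  imports
    "HOL-Computational_Algebra.Computational_Algebra"
    "HOL-Library.Groups_Big_Fun"
begin

type_synonym 'a infmat = "nat \<Rightarrow> nat \<Rightarrow> 'a"

definition lower_triangular :: "'a::zero infmat \<Rightarrow> bool" where
  "lower_triangular M \<longleftrightarrow> (\<forall>n k. n < k \<longrightarrow> M n k = 0)"

definition infmat_one :: "'a::zero_neq_one infmat" where
  "infmat_one n k = (if n = k then 1 else 0)"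

text \<open>
  The entries of a product are sums over all of \<open>nat\<close>; \<^const>\<open>Sum_any\<close> is the sum of the nonzero
  terms, of which there are finitely many as soon as the left factor has finite rows
  (in particular if it is lower triangular).
\<close>

definition infmat_mult :: "'a::semiring_0 infmat \<Rightarrow> 'a infmat \<Rightarrow> 'a infmat" where
  "infmat_mult M N n k = Sum_any (\<lambda>j. M n j * N j k)"

text \<open>
  The inverse is taken in the group of lower triangular matrices with nonzero diagonal;
  \<open>infmat_inv_correct\<close> below shows that it is well defined there.
\<close>

definition infmat_inv :: "'a::field infmat \<Rightarrow> 'a infmat" where
  "infmat_inv M = (THE L. lower_triangular L \<and>
     infmat_mult L M = infmat_one \<and> infmat_mult M L = infmat_one)"

definition delete_rows :: "nat \<Rightarrow> 'a infmat \<Rightarrow> 'a infmat" where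
  "delete_rows m M n k = M (n + m) k"

definition column_gf :: "'a infmat \<Rightarrow> nat \<Rightarrow> 'a fps" where
  "column_gf M k = Abs_fps (\<lambda>n. M n k)"

definition even_fps :: "'a::zero fps \<Rightarrow> bool" where
  "even_fps f \<longleftrightarrow> (\<forall>n. odd n \<longrightarrow> fps_nth f n = 0)"

definition odd_fps :: "'a::zero fps \<Rightarrow> bool" where
  "odd_fps f \<longleftrightarrow> (\<forall>n. even n \<longrightarrow> fps_nth f n = 0)"

definition dar_column ::
    "'a::field fps \<Rightarrow> 'a fps \<Rightarrow> 'a fps \<Rightarrow> 'a fps \<Rightarrow> nat \<Rightarrow> 'a fps" where
  "dar_column b g f1 f2 k =
     (if k = 0 then b
      else if odd k then fps_X * g * (f1 * f2) ^ ((k - 1) div 2)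
      else fps_X * g * f1 * (f1 * f2) ^ ((k - 2) div 2))"

definition double_almost_riordan ::
    "'a::field fps \<Rightarrow> 'a fps \<Rightarrow> 'a fps \<Rightarrow> 'a fps \<Rightarrow> 'a infmat" where
  "double_almost_riordan b g f1 f2 n k = fps_nth (dar_column b g f1 f2 k) n"

lemma infmat_mult_lower_triangular:
  assumes "lower_triangular M"
  shows "infmat_mult M N n k = (\<Sum>j\<le>n. M n j * N j k)"
  unfolding infmat_mult_def
proof (rule Sum_any.expand_superset)
  show "{j. M n j * N j k \<noteq> 0} \<subseteq> {..n}"
    using assms by (auto simp: lower_triangular_def intro: leI)
qed simp

lemma lower_triangular_infmat_mult:
  assumes "lower_triangular M" "lower_triangular N"
  shows "lower_triangular (infmat_mult M N)"
  using assms unfolding lower_triangular_def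
  by (auto simp: infmat_mult_lower_triangular[OF assms(1)] intro!: sum.neutral)

lemma infmat_mult_assoc:
  assumes "lower_triangular A" "lower_triangular B"
  shows "infmat_mult (infmat_mult A B) C = infmat_mult A (infmat_mult B C)"
proof (intro ext)
  fix n k
  have "infmat_mult (infmat_mult A B) C n k = (\<Sum>j\<le>n. (\<Sum>i\<le>n. A n i * B i j) * C j k)"
    by (simp add: infmat_mult_lower_triangular assms lower_triangular_infmat_mult)
  also have "\<dots> = (\<Sum>j\<le>n. \<Sum>i\<le>n. A n i * (B i j * C j k))"
    by (simp add: sum_distrib_right mult.assoc)
  also have "\<dots> = (\<Sum>i\<le>n. \<Sum>j\<le>n. A n i * (B i j * C j k))"
    by (rule sum.swap)
  also have "\<dots> = (\<Sum>i\<le>n. A n i * (\<Sum>j\<le>n. B i j * C j k))"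
    by (simp add: sum_distrib_left)
  also have "\<dots> = (\<Sum>i\<le>n. A n i * (\<Sum>j\<le>i. B i j * C j k))"
  proof -
    have "(\<Sum>j\<le>n. B i j * C j k) = (\<Sum>j\<le>i. B i j * C j k)" if "i \<le> n" for i
      using that assms(2) by (intro sum.mono_neutral_right) (auto simp: lower_triangular_def)
    then show ?thesis
      by simp
  qed
  also have "\<dots> = infmat_mult A (infmat_mult B C) n k"
    by (simp add: infmat_mult_lower_triangular assms)
  finally show "infmat_mult (infmat_mult A B) C n k = infmat_mult A (infmat_mult B C) n k" .
qed

lemma lower_triangular_infmat_one: "lower_triangular infmat_one"
  by (simp add: lower_triangular_def infmat_one_def)

lemma infmat_mult_one_left: "infmat_mult infmat_one M = (M :: 'a::semiring_1 infmat)"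
proof (intro ext)
  fix n k
  have "(\<Sum>j\<le>n. infmat_one n j * M j k) = (\<Sum>j\<le>n. if n = j then M j k else 0)"
    by (intro sum.cong) (auto simp: infmat_one_def)
  then show "infmat_mult infmat_one M n k = M n k"
    by (simp add: infmat_mult_lower_triangular lower_triangular_infmat_one)
qed

lemma infmat_mult_one_right:
  assumes "lower_triangular (M :: 'a::semiring_1 infmat)"
  shows "infmat_mult M infmat_one = M"
proof (intro ext)
  fix n k
  have "(\<Sum>j\<le>n. M n j * infmat_one j k) = (\<Sum>j\<le>n. if j = k then M n j else 0)"
    by (intro sum.cong) (auto simp: infmat_one_def)
  also have "\<dots> = M n k"
    using assms by (simp add: lower_triangular_def)
  finally show "infmat_mult M infmat_one n k = M n k"
    by (simp add: infmat_mult_lower_triangular assms)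
qed

lemma forward_substitution:
  fixes M :: "'a::field infmat"
  assumes "\<And>n. M n n \<noteq> 0"
  obtains x where "\<And>n. (\<Sum>j\<le>n. M n j * x j) = v n"
proof -
  define F where "F = (\<lambda>x n. (v n - (\<Sum>j<n. M n j * x j)) / M n n)"
  have "adm_wf {(i, j :: nat). i < j} F"
    unfolding adm_wf_def F_def by (auto intro!: sum.cong)
  moreover have "wf {(i, j :: nat). i < j}"
    by (rule wf)
  ultimately have "wfrec {(i, j). i < j} F = F (wfrec {(i, j). i < j} F)"
    by (intro wfrec_fixpoint) auto
  then obtain x where x: "x = F x"
    by metis
  have "(\<Sum>j\<le>n. M n j * x j) = v n" for n
  proof -
    have "x n * M n n = v n - (\<Sum>j<n. M n j * x j)"
      using assms[of n] by (subst x) (simp add: F_def)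
    then show ?thesis
      by (simp add: lessThan_Suc_atMost[symmetric] algebra_simps)
  qed
  then show ?thesis
    by (rule that)
qed

lemma right_inverse_exists:
  fixes M :: "'a::field infmat"
  assumes M: "lower_triangular M" and diag: "\<And>n. M n n \<noteq> 0"
  obtains R where "lower_triangular R" "\<And>n. R n n \<noteq> 0" "infmat_mult M R = infmat_one"
proof -
  have "\<exists>x. \<forall>n. (\<Sum>j\<le>n. M n j * x j) = infmat_one n k" for k
    by (rule forward_substitution[where M = M, OF diag, where v = "\<lambda>n. infmat_one n k"]) blast
  then obtain X where X: "\<And>k n. (\<Sum>j\<le>n. M n j * X k j) = infmat_one n k"
    by metis
  have zero: "X k n = 0" if "n < k" for n k
    using that
  proof (induction n rule: less_induct)
    case (less n)
    have "(\<Sum>j\<le>n. M n j * X k j) = (\<Sum>j\<in>{n}. M n j * X k j)"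
      using less by (intro sum.mono_neutral_right) auto
    moreover have "(\<Sum>j\<le>n. M n j * X k j) = 0"
      using less.prems by (simp add: X infmat_one_def)
    ultimately show ?case
      using diag[of n] by simp
  qed
  have "X n n \<noteq> 0" for n
  proof -
    have "(\<Sum>j\<le>n. M n j * X n j) = (\<Sum>j\<in>{n}. M n j * X n j)"
      using zero by (intro sum.mono_neutral_right) auto
    then show ?thesis
      using X[of n n] by (auto simp: infmat_one_def)
  qed
  moreover have "lower_triangular (\<lambda>n k. X k n)"
    using zero by (simp add: lower_triangular_def)
  moreover have "infmat_mult M (\<lambda>n k. X k n) = infmat_one"
    by (intro ext) (simp add: infmat_mult_lower_triangular[OF M] X)
  ultimately show ?thesis
    using that[of "\<lambda>n k. X k n"] by blast
qed

lemma infmat_inv_unique: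
  fixes M :: "'a::field infmat"
  assumes M: "lower_triangular M" and L: "lower_triangular L" "infmat_mult L M = infmat_one"
    and R: "lower_triangular R" "infmat_mult M R = infmat_one"
  shows "L = R"
  using infmat_mult_assoc[OF L(1) M, of R] L R
  by (simp add: infmat_mult_one_left infmat_mult_one_right)

theorem infmat_inv_correct:
  fixes M :: "'a::field infmat"
  assumes M: "lower_triangular M" and diag: "\<And>n. M n n \<noteq> 0"
  shows "lower_triangular (infmat_inv M)"
    and "infmat_mult (infmat_inv M) M = infmat_one"
    and "infmat_mult M (infmat_inv M) = infmat_one"
proof -
  obtain R where R: "lower_triangular R" "\<And>n. R n n \<noteq> 0" "infmat_mult M R = infmat_one"
    using right_inverse_exists[OF M diag] by metis
  obtain S where S: "lower_triangular S" "infmat_mult R S = infmat_one"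
    using right_inverse_exists[OF R(1,2)] by metis
  have "M = S"
    by (rule infmat_inv_unique[OF R(1) M R(3) S])
  with S R have "\<exists>!L. lower_triangular L \<and>
      infmat_mult L M = infmat_one \<and> infmat_mult M L = infmat_one"
    using infmat_inv_unique[OF M] by metis
  from theI'[OF this] show "lower_triangular (infmat_inv M)"
    and "infmat_mult (infmat_inv M) M = infmat_one"
    and "infmat_mult M (infmat_inv M) = infmat_one"
    unfolding infmat_inv_def by auto
qed

lemma subdegree_dar_column:
  fixes b g f1 f2 :: "'a::field fps"
  assumes "fps_nth b 0 \<noteq> 0" "fps_nth g 0 \<noteq> 0" "subdegree f1 = 1" "subdegree f2 = 1"
  shows "dar_column b g f1 f2 k \<noteq> 0" "subdegree (dar_column b g f1 f2 k) = k"
proof -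
  have nz: "b \<noteq> 0" "g \<noteq> 0" "f1 \<noteq> 0" "f2 \<noteq> 0"
    using assms by auto
  then show "dar_column b g f1 f2 k \<noteq> 0"
    by (simp add: dar_column_def)
  have "subdegree b = 0" "subdegree g = 0"
    using assms by auto
  then show "subdegree (dar_column b g f1 f2 k) = k"
    using nz assms by (simp add: dar_column_def) presburger
qed

lemma double_almost_riordan_triangular:
  fixes b g f1 f2 :: "'a::field fps"
  assumes "fps_nth b 0 \<noteq> 0" "fps_nth g 0 \<noteq> 0" "subdegree f1 = 1" "subdegree f2 = 1"
  shows "lower_triangular (double_almost_riordan b g f1 f2)"
    and "double_almost_riordan b g f1 f2 n n \<noteq> 0"
  using subdegree_dar_column[OF assms] nth_subdegree_nonzero[of "dar_column b g f1 f2 n"]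
  by (auto simp: lower_triangular_def double_almost_riordan_def intro!: nth_less_subdegree_zero)

end

theory Submission
  imports Defs
begin

text \<open>
  Column \<open>k\<close> of \<open>P\<close>, with generating function \<open>x\<close>, is the unique solution of \<open>D x = d\<close>, where \<open>d\<close> is
  column \<open>k\<close> of \<open>D\<close> with its first two entries deleted. Since \<open>D\<close> has a checkerboard pattern, \<open>x\<close> has
  the parity of \<open>k\<close>. The columns of \<open>D\<close> become geometric once multiplied by \<open>s\<close> (odd columns) or \<open>f2\<close>
  (even columns other than column 0), so \<open>D x = d\<close> turns into
  \<open>s d = t g x(s)\<close> for odd \<open>x\<close> and \<open>f2 d = t g x(s) + x\<^sub>0 (f2 b - t g)\<close> for even \<open>x\<close>.
  Substituting the compositional inverse of \<open>s\<close> for \<open>t\<close> then yields \<open>x\<close>.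
\<close>

section \<open>Parity of power series and the checkerboard pattern of \<open>D\<close>\<close>

text \<open>Only \<open>p\<close> modulo 2 matters. A natural number as index lets parities add
  under products, and lets \<open>k\<close> itself serve as the parity of column
  \<open>k\<close>.\<close>

definition fps_parity :: "nat \<Rightarrow> 'a::zero fps \<Rightarrow> bool" where
  "fps_parity p f \<longleftrightarrow> (\<forall>n. odd (n + p) \<longrightarrow> fps_nth f n = 0)"

lemma fps_parity_mult:
  fixes f g :: "'a::semiring_0 fps"
  assumes "fps_parity p f" "fps_parity q g"
  shows "fps_parity (p + q) (f * g)"
  unfolding fps_parity_def
proof (intro allI impI)
  fix n assume n: "odd (n + (p + q))"
  have "fps_nth f i * fps_nth g (n - i) = 0" if "i \<le> n" for i
  proof (cases "odd (i + p)")
    case False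
    with n that have "odd (n - i + q)"
      by presburger
    with assms(2) show ?thesis
      by (simp add: fps_parity_def)
  qed (use assms(1) in \<open>simp add: fps_parity_def\<close>)
  then show "fps_nth (f * g) n = 0"
    by (simp add: fps_mult_nth)
qed

lemma fps_parity_cong: "even (p + q) \<Longrightarrow> fps_parity p f \<Longrightarrow> fps_parity q f"
  by (auto simp: fps_parity_def)

lemma fps_parity_0_power:
  fixes f :: "'a::semiring_1 fps"
  assumes "fps_parity 0 f"
  shows "fps_parity 0 (f ^ n)"
proof (induction n)
  case 0
  show ?case
    by (auto simp: fps_parity_def)
next
  case (Suc n)
  show ?case
    using fps_parity_mult[OF assms Suc] by simp
qed

lemma fps_parity_dar_column:
  fixes b g f1 f2 :: "'a::field fps"
  assumes "even_fps b" "even_fps g" "odd_fps f1" "odd_fps f2"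
  shows "fps_parity k (dar_column b g f1 f2 k)"
proof -
  have par: "fps_parity 0 b" "fps_parity 0 g" "fps_parity 1 f1" "fps_parity 1 f2"
    using assms by (auto simp: fps_parity_def even_fps_def odd_fps_def)
  have X: "fps_parity 1 (fps_X :: 'a fps)"
    by (auto simp: fps_parity_def fps_X_def)
  have pow: "fps_parity 0 ((f1 * f2) ^ l)" for l
    using fps_parity_cong[OF _ fps_parity_mult[OF par(3,4)], of 0]
    by (intro fps_parity_0_power) simp
  consider "k = 0" | "odd k" | "even k" "k \<noteq> 0"
    by blast
  then show ?thesis
  proof cases
    case 1
    then show ?thesis
      using par by (simp add: dar_column_def)
  next
    case 2
    then show ?thesis
      using fps_parity_cong[OF _ fps_parity_mult[OF fps_parity_mult[OF X par(2)] pow], of k]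
      by (auto simp: dar_column_def)
  next
    case 3
    then show ?thesis
      using fps_parity_cong[OF _ fps_parity_mult[OF fps_parity_mult[OF
            fps_parity_mult[OF X par(2)] par(3)] pow], of k]
      by (auto simp: dar_column_def)
  qed
qed

section \<open>Series combinations of columns\<close>

text \<open>
  Truncating the sum at \<open>n\<close> loses nothing when \<open>c j\<close> has order at least \<open>j\<close>; only then is this
  the series \<open>\<Sum>j. x\<^sub>j c\<^sub>j\<close>.
\<close>

definition fps_lincomb :: "'a::comm_ring_1 fps \<Rightarrow> (nat \<Rightarrow> 'a fps) \<Rightarrow> 'a fps" where
  "fps_lincomb x c = Abs_fps (\<lambda>n. \<Sum>j\<le>n. fps_nth x j * fps_nth (c j) n)"

text \<open>Asking for equality only on the support of \<open>x\<close> lets the parity of a column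
  of \<open>P\<close> select the columns of \<open>D\<close> with one geometric pattern.\<close>

lemma fps_lincomb_cong:
  assumes "\<And>j. fps_nth x j \<noteq> 0 \<Longrightarrow> c j = c' j"
  shows "fps_lincomb x c = fps_lincomb x c'"
proof -
  have "fps_nth x j * fps_nth (c j) n = fps_nth x j * fps_nth (c' j) n" for j n
    using assms[of j] by (cases "fps_nth x j = 0") auto
  then show ?thesis
    by (simp add: fps_lincomb_def)
qed

lemma fps_lincomb_mult:
  assumes "\<And>j n. n < j \<Longrightarrow> fps_nth (c j) n = 0"
  shows "fps_lincomb x (\<lambda>j. u * c j) = u * fps_lincomb x c"
proof (rule fps_ext)
  fix n
  have "fps_nth (fps_lincomb x (\<lambda>j. u * c j)) n
      = (\<Sum>j\<le>n. \<Sum>i=0..n. fps_nth u i * (fps_nth x j * fps_nth (c j) (n - i)))"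
    by (simp add: fps_lincomb_def fps_mult_nth sum_distrib_left mult_ac)
  also have "\<dots> = (\<Sum>i=0..n. \<Sum>j\<le>n. fps_nth u i * (fps_nth x j * fps_nth (c j) (n - i)))"
    by (rule sum.swap)
  \<comment> \<open>The terms with \<open>j > n - i\<close> vanish by the order condition; what
    remains is the truncation used by \<open>fps_lincomb\<close> at coefficient
    \<open>n - i\<close>.\<close>
  also have "\<dots> = (\<Sum>i=0..n. \<Sum>j\<le>n - i. fps_nth u i * (fps_nth x j * fps_nth (c j) (n - i)))"
    by (intro sum.cong refl sum.mono_neutral_right) (auto simp: assms)
  also have "\<dots> = fps_nth (u * fps_lincomb x c) n"
    by (simp add: fps_lincomb_def fps_mult_nth sum_distrib_left)
  finally show "fps_nth (fps_lincomb x (\<lambda>j. u * c j)) n = fps_nth (u * fps_lincomb x c) n" .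
qed

lemma fps_lincomb_add: "fps_lincomb x (\<lambda>j. c j + c' j) = fps_lincomb x c + fps_lincomb x c'"
  by (rule fps_ext) (simp add: fps_lincomb_def distrib_left sum.distrib)

lemma fps_lincomb_single:
  "fps_lincomb x (\<lambda>j. if j = 0 then u else 0) = fps_const (fps_nth x 0) * u"
proof (rule fps_ext)
  fix n
  have "(\<Sum>j\<le>n. fps_nth x j * fps_nth (if j = 0 then u else 0) n)
      = (\<Sum>j\<le>n. if j = 0 then fps_nth x 0 * fps_nth u n else 0)"
    by (intro sum.cong) auto
  then show "fps_nth (fps_lincomb x (\<lambda>j. if j = 0 then u else 0)) n
      = fps_nth (fps_const (fps_nth x 0) * u) n"
    by (simp add: fps_lincomb_def)
qed

text \<open>Composition is itself given by this sum truncated at \<open>n\<close>.\<close>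

lemma fps_lincomb_power: "fps_lincomb x (\<lambda>j. s ^ j) = fps_compose x s"
  by (rule fps_ext) (simp add: fps_lincomb_def fps_compose_nth atMost_atLeast0)

text \<open>Expresses the deletion of two rows through ring operations, which substitution respects,
  unlike a shift.\<close>

lemma fps_X_power2_mult_shift:
  "fps_X ^ 2 * fps_shift 2 f
    = f - fps_const (fps_nth f 0) - fps_const (fps_nth f 1) * (fps_X :: 'a::comm_ring_1 fps)"
proof (rule fps_ext)
  fix n :: nat
  consider "n = 0" | "n = 1" | m where "n = m + 2"
    by (metis One_nat_def add_2_eq_Suc' not0_implies_Suc)
  then show "fps_nth (fps_X ^ 2 * fps_shift 2 f) n
    = fps_nth (f - fps_const (fps_nth f 0) - fps_const (fps_nth f 1) * (fps_X :: 'a::comm_ring_1 fps)) n"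
    by cases (auto simp: fps_X_power_mult_nth)
qed

section \<open>The production matrix and the equations for its columns\<close>

locale double_almost_riordan_parity =
  fixes b g f1 f2 s :: "'a::field_char_0 fps"
  assumes even_b: "even_fps b" and b0: "fps_nth b 0 \<noteq> 0"
    and even_g: "even_fps g" and g0: "fps_nth g 0 \<noteq> 0"
    and odd_f1: "odd_fps f1" and deg_f1: "subdegree f1 = 1"
    and odd_f2: "odd_fps f2" and deg_f2: "subdegree f2 = 1"
    and deg_s: "subdegree s = 1" and s_square: "s ^ 2 = f1 * f2"
begin

abbreviation col :: "nat \<Rightarrow> 'a fps" where
  "col \<equiv> dar_column b g f1 f2"

abbreviation D :: "'a infmat" where
  "D \<equiv> double_almost_riordan b g f1 f2"

definition P :: "'a infmat" where
  "P = infmat_mult (infmat_inv D) (delete_rows 2 D)"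

definition h :: "'a fps" where
  "h = fps_inv s"

lemmas D_triangular = double_almost_riordan_triangular[OF b0 g0 deg_f1 deg_f2]

lemma nth_col_less: "n < k \<Longrightarrow> fps_nth (col k) n = 0"
  using D_triangular(1) by (simp add: lower_triangular_def double_almost_riordan_def)

lemma nth_col_odd: "odd (n + k) \<Longrightarrow> fps_nth (col k) n = 0"
  using fps_parity_dar_column[OF even_b even_g odd_f1 odd_f2] by (simp add: fps_parity_def)

text \<open>Multiplying by \<open>D\<close> on the left removes the inverse. Associativity asks for
  triangularity of the two left factors only, so it covers \<open>delete_rows 2 D\<close>, which is
  not triangular.\<close>

lemma D_mult_P: "(\<Sum>j\<le>n. D n j * P j k) = D (n + 2) k"
proof -
  note inv = infmat_inv_correct[OF D_triangular]
  have "infmat_mult D P = infmat_mult (infmat_mult D (infmat_inv D)) (delete_rows 2 D)"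
    unfolding P_def by (rule infmat_mult_assoc[OF D_triangular(1) inv(1), symmetric])
  also have "\<dots> = delete_rows 2 D"
    by (simp only: inv(3) infmat_mult_one_left)
  finally show ?thesis
    using infmat_mult_lower_triangular[OF D_triangular(1), of P n k]
    by (simp add: delete_rows_def)
qed

text \<open>Induction along forward substitution: for \<open>j < n\<close> one of
  \<open>D n j\<close> and \<open>P j k\<close> vanishes by parity, and so does the right-hand side
  \<open>D (n + 2) k\<close>. Only the diagonal term is left, and \<open>D n n\<close> is
  nonzero.\<close>

lemma P_odd: "odd (n + k) \<Longrightarrow> P n k = 0"
proof (induction n rule: less_induct)
  case (less n)
  have "D n j * P j k = 0" if "j < n" for j
  proof (cases "odd (j + k)")
    case False
    with less.prems have "odd (n + j)"
      by presburger
    then show ?thesis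
      by (simp add: double_almost_riordan_def nth_col_odd)
  qed (use less that in simp)
  then have "D n n * P n k = (\<Sum>j\<le>n. D n j * P j k)"
    by (simp add: lessThan_Suc_atMost[symmetric] del: mult_eq_0_iff)
  also have "\<dots> = 0"
    using less.prems unfolding D_mult_P by (simp add: double_almost_riordan_def nth_col_odd)
  finally show ?case
    using D_triangular(2)[of n] by simp
qed

lemma P_0: "P 0 k = fps_nth (col k) 2 / fps_nth b 0"
  using D_mult_P[of 0 k] b0
  by (simp add: double_almost_riordan_def dar_column_def[of b g f1 f2 0] field_simps numeral_2_eq_2)

lemma nth_column_P: "fps_nth (column_gf P k) n = P n k"
  by (simp add: column_gf_def)

lemma lincomb_column_P: "fps_lincomb (column_gf P k) col = fps_shift 2 (col k)"
  using D_mult_P by (intro fps_ext)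
    (simp add: fps_lincomb_def column_gf_def double_almost_riordan_def mult.commute)

lemma s_nth: "fps_nth s 0 = 0" "fps_nth s 1 \<noteq> 0"
proof -
  show "fps_nth s 0 = 0"
    using deg_s by (intro nth_less_subdegree_zero) simp
  show "fps_nth s 1 \<noteq> 0"
    using deg_s nth_subdegree_nonzero[of s] by force
qed

lemma s_power_nth_less: "n < j \<Longrightarrow> fps_nth (s ^ j) n = 0"
  using s_nth(1) by (simp add: startsby_zero_power_prefix)

lemma mult_col_odd: "odd k \<Longrightarrow> s * col k = fps_X * g * s ^ k"
  by (auto simp: dar_column_def s_square[symmetric] power_mult[symmetric] mult_ac elim!: oddE)

text \<open>The factor \<open>f2\<close> completes the unpaired \<open>f1\<close> to
  \<open>s ^ 2\<close>. Column 0, being \<open>b\<close>, does not follow this pattern.\<close>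

lemma mult_col_even: "even k \<Longrightarrow> k \<noteq> 0 \<Longrightarrow> f2 * col k = fps_X * g * s ^ k"
proof -
  assume "even k" "k \<noteq> 0"
  then obtain l where k: "k = 2 * l + 2"
    by (metis add_2_eq_Suc' dvd_def mult_Suc_right mult_is_0 not0_implies_Suc add.commute)
  have "f2 * col k = fps_X * g * ((f1 * f2) ^ l * (f1 * f2))"
    by (simp add: k dar_column_def mult_ac)
  also have "\<dots> = fps_X * g * s ^ k"
    by (simp only: s_square[symmetric] k power_add power_mult)
  finally show ?thesis .
qed

lemma column_P_odd:
  assumes "odd k"
  shows "s * fps_shift 2 (col k) = fps_X * g * fps_compose (column_gf P k) s"
proof -
  have "s * fps_shift 2 (col k) = fps_lincomb (column_gf P k) (\<lambda>j. s * col j)"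
    using fps_lincomb_mult[of col] nth_col_less by (simp add: lincomb_column_P)
  also have "\<dots> = fps_lincomb (column_gf P k) (\<lambda>j. (fps_X * g) * s ^ j)"
    using P_odd assms by (intro fps_lincomb_cong mult_col_odd) (auto simp: nth_column_P)
  also have "\<dots> = fps_X * g * fps_compose (column_gf P k) s"
    by (simp add: fps_lincomb_mult s_power_nth_less fps_lincomb_power)
  finally show ?thesis .
qed

text \<open>Column 0 contributes \<open>f2 * b\<close> where the geometric pattern has
  \<open>fps_X * g\<close>; the last summand corrects this difference, weighted by the entry
  \<open>P 0 k\<close>.\<close>

lemma column_P_even:
  assumes "even k"
  shows "f2 * fps_shift 2 (col k) =
    fps_X * g * fps_compose (column_gf P k) s + fps_const (P 0 k) * (f2 * b - fps_X * g)"
proof -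
  have "f2 * fps_shift 2 (col k) = fps_lincomb (column_gf P k) (\<lambda>j. f2 * col j)"
    using fps_lincomb_mult[of col] nth_col_less by (simp add: lincomb_column_P)
  also have "\<dots> = fps_lincomb (column_gf P k)
      (\<lambda>j. (fps_X * g) * s ^ j + (if j = 0 then f2 * b - fps_X * g else 0))"
  proof (rule fps_lincomb_cong)
    fix j
    assume "fps_nth (column_gf P k) j \<noteq> 0"
    then have "even j"
      using P_odd[of j k] assms by (auto simp: nth_column_P)
    then show "f2 * col j = (fps_X * g) * s ^ j + (if j = 0 then f2 * b - fps_X * g else 0)"
      using mult_col_even[of j] by (auto simp: dar_column_def[of b g f1 f2 0])
  qed
  also have "\<dots> = fps_X * g * fps_compose (column_gf P k) s
      + fps_const (P 0 k) * (f2 * b - fps_X * g)"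
    by (simp add: fps_lincomb_add fps_lincomb_single fps_lincomb_mult s_power_nth_less
        fps_lincomb_power nth_column_P)
  finally show ?thesis .
qed

section \<open>Substituting the compositional inverse, in Laurent series\<close>

lemma h_nth_0: "fps_nth h 0 = 0"
  by (simp add: h_def fps_inv_def)

lemma s_compose_h: "fps_compose s h = fps_X"
  unfolding h_def using s_nth by (rule fps_inv_right)

lemma compose_s_h: "fps_compose (fps_compose x s) h = x"
  using fps_compose_assoc[OF h_nth_0 s_nth(1), of x] by (simp add: s_compose_h)

lemmas compose_h_simps =
  fps_compose_mult_distrib[OF h_nth_0] fps_compose_add_distrib fps_compose_sub_distrib
  fps_compose_power[OF h_nth_0, symmetric] s_compose_h compose_s_h
  fps_X_fps_compose_startby0[OF h_nth_0]

text \<open>The closed forms divide by powers of \<open>h\<close>, which has no constant term;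
  Laurent series form a field in which this is exact.\<close>

abbreviation subst_h :: "'a fps \<Rightarrow> 'a fls" where
  "subst_h f \<equiv> fps_to_fls (fps_compose f h)"

abbreviation H :: "'a fls" where
  "H \<equiv> fps_to_fls h"

text \<open>If \<open>h\<close> were 0, then \<open>s\<close> composed with \<open>h\<close> would
  be the constant term 0 of \<open>s\<close> instead of \<open>fps_X\<close>.\<close>

lemma h_nonzero: "H \<noteq> 0"
  using s_compose_h s_nth(1) by auto

lemma subst_g_nonzero: "subst_h g \<noteq> 0"
  using g0 by (metis fps_compose_nth_0 fps_to_fls_eq_0_iff fps_zero_nth)

text \<open>Multiply \<open>column_P_odd\<close> by \<open>fps_X ^ 2\<close>, substitute
  \<open>h\<close> and solve. In \<open>H ^ 3\<close>, two factors come from the deleted rows and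
  one from the \<open>fps_X\<close> in \<open>fps_X * g\<close>.\<close>

lemma fls_column_P_odd:
  assumes "odd k"
  shows "fps_to_fls (column_gf P k) =
    fls_X * (subst_h (col k) - fls_const (fps_nth (col k) 1) * H) / (H ^ 3 * subst_h g)"
proof -
  have 0: "fps_nth (col k) 0 = 0"
    using assms by (intro nth_col_odd) simp
  have "s * (col k - fps_const (fps_nth (col k) 1) * fps_X)
      = fps_X ^ 3 * g * fps_compose (column_gf P k) s"
    using column_P_odd[OF assms] fps_X_power2_mult_shift[of "col k"] unfolding 0 by simp algebra
  from arg_cong[OF this, of subst_h]
  have "fls_X * (subst_h (col k) - fls_const (fps_nth (col k) 1) * H)
      = H ^ 3 * subst_h g * fps_to_fls (column_gf P k)"
    by (simp add: compose_h_simps fls_times_fps_to_fls fps_to_fls_power)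
  then show ?thesis
    using h_nonzero subst_g_nonzero by (simp add: field_simps)
qed

lemma fls_column_P_even:
  assumes "even k"
  shows "fps_to_fls (column_gf P k) =
    (subst_h f2 * (subst_h (col k) - fls_const (fps_nth (col k) 0))
      - fls_const (P 0 k) * H ^ 2 * (subst_h f2 * subst_h b - H * subst_h g))
      / (H ^ 3 * subst_h g)"
proof -
  have 1: "fps_nth (col k) 1 = 0"
    using assms by (intro nth_col_odd) simp
  have "f2 * (col k - fps_const (fps_nth (col k) 0)) =
      fps_X ^ 3 * g * fps_compose (column_gf P k) s
      + fps_const (P 0 k) * fps_X ^ 2 * (f2 * b - fps_X * g)"
    using column_P_even[OF assms] fps_X_power2_mult_shift[of "col k"] unfolding 1 by simp algebra
  from arg_cong[OF this, of subst_h]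
  have "subst_h f2 * (subst_h (col k) - fls_const (fps_nth (col k) 0))
      = H ^ 3 * subst_h g * fps_to_fls (column_gf P k)
      + fls_const (P 0 k) * H ^ 2 * (subst_h f2 * subst_h b - H * subst_h g)"
    by (simp add: compose_h_simps fls_times_fps_to_fls fps_to_fls_power)
  then show ?thesis
    using h_nonzero subst_g_nonzero by (simp add: field_simps)
qed

section \<open>Closed forms of the columns of \<open>P\<close>\<close>

lemma subst_col_odd: "odd k \<Longrightarrow> fls_X * subst_h (col k) = H * subst_h g * fls_X ^ k"
  using arg_cong[OF mult_col_odd, of k subst_h]
  by (simp add: compose_h_simps fls_times_fps_to_fls fps_to_fls_power)

lemma subst_col_even:
  "even k \<Longrightarrow> k \<noteq> 0 \<Longrightarrow> subst_h f2 * subst_h (col k) = H * subst_h g * fls_X ^ k"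
  using arg_cong[OF mult_col_even, of k subst_h]
  by (simp add: compose_h_simps fls_times_fps_to_fls fps_to_fls_power)

lemma col_2_nth_2: "fps_nth (col 2) 2 = fps_nth g 0 * fps_nth f1 1"
proof -
  have "fps_nth f1 0 = 0"
    using deg_f1 by (intro nth_less_subdegree_zero) simp
  then show ?thesis
    by (simp add: dar_column_def mult.assoc numeral_2_eq_2 fps_mult_nth)
qed

lemma column_0: "fps_to_fls (column_gf P 0) =
  fls_const (fps_nth b 2) / fls_const (fps_nth b 0)
  + subst_h f2 / (fls_const (fps_nth b 0) * H ^ 3 * subst_h g)
    * (subst_h b * (fls_const (fps_nth b 0) - fls_const (fps_nth b 2) * H ^ 2)
       - fls_const (fps_nth b 0) ^ 2)"
proof -
  have "fls_const (P 0 0) = fls_const (fps_nth b 2) / fls_const (fps_nth b 0)"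
    by (simp add: P_0 dar_column_def fls_const_divide_const)
  moreover have "col 0 = b"
    by (simp add: dar_column_def)
  \<comment> \<open>The general even formula with \<open>F\<close>, \<open>B\<close>,
    \<open>G\<close> for \<open>f2\<close>, \<open>b\<close>, \<open>g\<close> at \<open>h\<close>,
    with \<open>x\<close> for \<open>H\<close>, and with \<open>a\<close>, \<open>c\<close> for the
    coefficients 2 and 0 of \<open>b\<close>, so that \<open>P 0 0\<close> is
    \<open>a / c\<close>.\<close>
  moreover have "(F * (B - c) - a / c * x ^ 2 * (F * B - x * G)) / (x ^ 3 * G)
      = a / c + F / (c * x ^ 3 * G) * (B * (c - a * x ^ 2) - c ^ 2)"
    if "c \<noteq> 0" "x \<noteq> 0" "G \<noteq> 0" for F B G a c x :: "'a fls"
    using that by (simp add: divide_simps) algebra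
  ultimately show ?thesis
    using h_nonzero subst_g_nonzero b0 fls_column_P_even[of 0] by simp
qed

lemma column_1: "fps_to_fls (column_gf P 1) =
  fls_X * (1 / H ^ 2 * (1 - fls_const (fps_nth g 0) / subst_h g))"
proof -
  have "subst_h (col 1) = H * subst_h g" "fps_nth (col 1) 1 = fps_nth g 0"
    by (simp_all add: dar_column_def compose_h_simps fls_times_fps_to_fls)
  then show ?thesis
    using h_nonzero subst_g_nonzero
    by (simp add: fls_column_P_odd divide_simps)
      (simp add: algebra_simps power2_eq_square power3_eq_cube)
qed

lemma column_2: "fps_to_fls (column_gf P 2) =
  fls_const (fps_nth g 0) * fls_const (fps_nth f1 1) / fls_const (fps_nth b 0)
  + fls_X ^ 2 / H ^ 2
  - (fls_const (fps_nth g 0) * fls_const (fps_nth f1 1) * subst_h b * subst_h f2)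
    / (fls_const (fps_nth b 0) * H * subst_h g)"
proof -
  have "fls_const (P 0 2)
      = fls_const (fps_nth g 0) * fls_const (fps_nth f1 1) / fls_const (fps_nth b 0)"
    by (simp add: P_0 col_2_nth_2 fls_const_divide_const)
  moreover have "subst_h f2 * subst_h (col 2) = H * subst_h g * fls_X ^ 2"
    by (rule subst_col_even) auto
  moreover have "fps_nth (col 2) 0 = 0"
    by (simp add: nth_col_less)
  \<comment> \<open>Here \<open>y\<close> is \<open>fls_X\<close> and \<open>a\<close> is the entry
    of \<open>D\<close> in row 2 and column 2; the product of \<open>f2\<close> and column 2 has
    already become \<open>x * G * y ^ 2\<close>.\<close>
  moreover have "(x * G * y ^ 2 - a / c * x ^ 2 * (F * B - x * G)) / (x ^ 3 * G)
      = a / c + y ^ 2 / x ^ 2 - a * B * F / (c * x * G)"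
    if "c \<noteq> 0" "x \<noteq> 0" "G \<noteq> 0" for F B G a c x y :: "'a fls"
    using that by (simp add: divide_simps) algebra
  ultimately show ?thesis
    using h_nonzero subst_g_nonzero b0 fls_column_P_even[of 2] by simp
qed

text \<open>From column 3 on, the coefficients 0, 1 and 2 of \<open>col k\<close> vanish, hence also
  \<open>P 0 k\<close>. All correction terms drop out and the two parities give the same
  formula.\<close>

lemma column_ge_3:
  assumes "k \<ge> 3"
  shows "fps_to_fls (column_gf P k) = fls_X ^ (k - 2) * (fls_X ^ 2 / H ^ 2)"
proof -
  have "fps_to_fls (column_gf P k) = H * subst_h g * fls_X ^ k / (H ^ 3 * subst_h g)"
  proof (cases "odd k")
    case True
    then show ?thesis
      using assms by (simp add: fls_column_P_odd subst_col_odd nth_col_less)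
  next
    case False
    with assms show ?thesis
      by (simp add: fls_column_P_even subst_col_even nth_col_less P_0)
  qed
  also have "\<dots> = fls_X ^ k / H ^ 2"
    using h_nonzero subst_g_nonzero by (simp add: power2_eq_square power3_eq_cube)
  also have "fls_X ^ k = (fls_X ^ (k - 2) * fls_X ^ 2 :: 'a fls)"
    using assms power_add[of "fls_X :: 'a fls" "k - 2" 2] by (simp only: le_add_diff_inverse2)
  finally show ?thesis
    by simp
qed

end

theorem theorem3p2:
  fixes b g f1 f2 s :: "'a::field_char_0 fps"
  assumes "even_fps b" and "fps_nth b 0 \<noteq> 0"
    and "even_fps g" and "fps_nth g 0 \<noteq> 0"
    and "odd_fps f1" and "subdegree f1 = 1"
    and "odd_fps f2" and "subdegree f2 = 1"
    and "odd_fps s" and "subdegree s = 1" and "s ^ 2 = f1 * f2"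
  shows
    "let D = double_almost_riordan b g f1 f2;
         P = infmat_mult (infmat_inv D) (delete_rows 2 D);
         t = fls_X;
         h = fps_to_fls (fps_inv s);
         b_h = fps_to_fls (fps_compose b (fps_inv s));
         g_h = fps_to_fls (fps_compose g (fps_inv s));
         f2_h = fps_to_fls (fps_compose f2 (fps_inv s));
         b0 = fls_const (fps_nth b 0);
         b2 = fls_const (fps_nth b 2);
         g0 = fls_const (fps_nth g 0);
         f11 = fls_const (fps_nth f1 1);
         W = b2 / b0 + f2_h / (b0 * h ^ 3 * g_h) * (b_h * (b0 - b2 * h ^ 2) - b0 ^ 2);
         Z1 = 1 / h ^ 2 * (1 - g0 / g_h);
         Z2 = g0 * f11 / b0 + t ^ 2 / h ^ 2 - (g0 * f11 * b_h * f2_h) / (b0 * h * g_h);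
         A = t ^ 2 / h ^ 2
     in fps_to_fls (column_gf P 0) = W \<and>
        fps_to_fls (column_gf P 1) = t * Z1 \<and>
        fps_to_fls (column_gf P 2) = Z2 \<and>
        (\<forall>k\<ge>3. fps_to_fls (column_gf P k) = t ^ (k - 2) * A)"
proof -
  interpret double_almost_riordan_parity b g f1 f2 s
    by unfold_locales fact+
  show ?thesis
    unfolding Let_def
    by (intro conjI allI impI column_0[unfolded P_def h_def] column_1[unfolded P_def h_def]
        column_2[unfolded P_def h_def] column_ge_3[unfolded P_def h_def])
qed

end
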